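(* Let $F:\mathcal{A}\to\mathcal{C}$ and $G:\mathcal{B}\to\mathcal{C}$ be functors, $\mathcal{G}=(F\downarrow G)$, and $\mathscr{N}:\mathcal{TG}\to\mathcal{G}$ the inclusion of the full subcategory of cosimple objects. Assume $\mathcal{B}$ is coregular and $G$ is faithful and has a left adjoint $G^{\diamond}$ with unit $\delta:\mathrm{id}_{\mathcal{C}}\to GG^{\diamond}$. For $(A,f,B)$ in $\mathcal{G}$ let $\tilde f:G^{\diamond}F(A)\to B$ be the unique morphism with $G(\tilde f)\circ\delta_{F(A)}=f$, let $\tilde f=m_{\tilde f}\circ e_{\tilde f}$ be a coimage factorization with $e_{\tilde f}:G^{\diamond}F(A)\to\mathrm{coran}(\tilde f)$ an epimorphism and $m_{\tilde f}:\mathrm{coran}(\tilde f)\to B$ a regular monomorphism, and define $\mathcal{T}(A,f,B)=(A,G(e_{\tilde f})\circ\delta_{F(A)},\mathrm{coran}(\tilde f))$ and $\vartheta_{(A,f,B)}=(\mathrm{id}_A,m_{\tilde f}):\mathcal{T}(A,f,B)\to(A,f,B)$. If $(A,f,B)$ is cosimple and $(\phi,\psi):\mathscr{N}(A,f,B)\to(A',f',B')$ is a morphism in $\mathcal{G}$, then there is a unique morphism $(\tilde\phi,\tilde\psi):(A,f,B)\to\mathcal{T}(A',f',B')$ in $\mathcal{G}$ such that $\vartheta_{(A',f',B')}\circ(\tilde\phi,\tilde\psi)=(\phi,\psi)$.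
   Context: The comma category $(F\downarrow G)$ has objects $(A,f,B)$ with $A\in\mathcal{A}$, $B\in\mathcal{B}$, $f:F(A)\to G(B)$ in $\mathcal{C}$, and morphisms $(\phi,\psi):(A,f,B)\to(A',f',B')$ with $f'\circ F(\phi)=G(\psi)\circ f$. An object $(A,f,B)$ is cosimple if $f$ is an epimorphism in $\mathcal{C}$. A coregular category (the dual of a regular category) has (epi, regular mono) coimage factorizations of every morphism. *)

theory Defs
  imports Main
begin

record ('o, 'm) category =
  Obj :: "'o set"
  Arr :: "'m set"
  Dom :: "'m \<Rightarrow> 'o"
  Cod :: "'m \<Rightarrow> 'o"
  Ident :: "'o \<Rightarrow> 'm"
  Comp :: "'m \<Rightarrow> 'm \<Rightarrow> 'm"  (infixl "\<cdot>\<index>" 70)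

definition hom :: "('o, 'm, 'z) category_scheme \<Rightarrow> 'o \<Rightarrow> 'o \<Rightarrow> 'm set" where
  "hom C X Y = {f \<in> Arr C. Dom C f = X \<and> Cod C f = Y}"

text \<open>\<open>g \<cdot> f\<close> is \<open>g\<close> after \<open>f\<close>; its value is unconstrained when \<open>f\<close> and \<open>g\<close> are not composable.\<close>

locale category =
  fixes C :: "('o, 'm) category" (structure)
  assumes Dom_Obj: "f \<in> Arr C \<Longrightarrow> Dom C f \<in> Obj C"
    and Cod_Obj: "f \<in> Arr C \<Longrightarrow> Cod C f \<in> Obj C"
    and Ident_hom: "X \<in> Obj C \<Longrightarrow> Ident C X \<in> hom C X X"
    and Comp_hom: "f \<in> hom C X Y \<Longrightarrow> g \<in> hom C Y Z \<Longrightarrow> g \<cdot> f \<in> hom C X Z"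
    and Comp_Ident: "f \<in> hom C X Y \<Longrightarrow> f \<cdot> Ident C X = f"
    and Ident_Comp: "f \<in> hom C X Y \<Longrightarrow> Ident C Y \<cdot> f = f"
    and Comp_assoc: "f \<in> hom C W X \<Longrightarrow> g \<in> hom C X Y \<Longrightarrow> h \<in> hom C Y Z
      \<Longrightarrow> (h \<cdot> g) \<cdot> f = h \<cdot> (g \<cdot> f)"

definition opposite :: "('o, 'm) category \<Rightarrow> ('o, 'm) category" where
  "opposite C = \<lparr>Obj = Obj C, Arr = Arr C, Dom = Cod C, Cod = Dom C, Ident = Ident C,
     Comp = (\<lambda>g f. f \<cdot>\<^bsub>C\<^esub> g)\<rparr>"

definition full_subcategory :: "('o, 'm) category \<Rightarrow> 'o set \<Rightarrow> ('o, 'm) category" where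
  "full_subcategory C S = C\<lparr>Obj := Obj C \<inter> S, Arr := {f \<in> Arr C. Dom C f \<in> S \<and> Cod C f \<in> S}\<rparr>"

definition epi :: "('o, 'm) category \<Rightarrow> 'm \<Rightarrow> bool" where
  "epi C e \<longleftrightarrow> e \<in> Arr C \<and>
     (\<forall>Z. \<forall>g \<in> hom C (Cod C e) Z. \<forall>h \<in> hom C (Cod C e) Z. g \<cdot>\<^bsub>C\<^esub> e = h \<cdot>\<^bsub>C\<^esub> e \<longrightarrow> g = h)"

record ('o, 'm, 'o2, 'm2) functor_data =
  FObj :: "'o \<Rightarrow> 'o2"
  FArr :: "'m \<Rightarrow> 'm2"

locale cat_functor = dom: category C + cod: category D
  for C :: "('o, 'm) category" and D :: "('o2, 'm2) category" +
  fixes F :: "('o, 'm, 'o2, 'm2) functor_data"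
  assumes FObj_Obj: "X \<in> Obj C \<Longrightarrow> FObj F X \<in> Obj D"
    and FArr_hom: "f \<in> hom C X Y \<Longrightarrow> FArr F f \<in> hom D (FObj F X) (FObj F Y)"
    and FArr_Ident: "X \<in> Obj C \<Longrightarrow> FArr F (Ident C X) = Ident D (FObj F X)"
    and FArr_Comp: "f \<in> hom C X Y \<Longrightarrow> g \<in> hom C Y Z
      \<Longrightarrow> FArr F (g \<cdot>\<^bsub>C\<^esub> f) = FArr F g \<cdot>\<^bsub>D\<^esub> FArr F f"

definition id_functor :: "('o, 'm, 'o, 'm) functor_data" where
  "id_functor = \<lparr>FObj = (\<lambda>X. X), FArr = (\<lambda>f. f)\<rparr>"

definition comp_functor ::
  "('o2, 'm2, 'o3, 'm3) functor_data \<Rightarrow> ('o, 'm, 'o2, 'm2) functor_data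
    \<Rightarrow> ('o, 'm, 'o3, 'm3) functor_data" where
  "comp_functor G F = \<lparr>FObj = FObj G \<circ> FObj F, FArr = FArr G \<circ> FArr F\<rparr>"

text \<open>The raw data of the inclusion of a full subcategory are identity maps.\<close>

definition inclusion_functor :: "('o, 'm, 'o, 'm) functor_data" where
  "inclusion_functor = id_functor"

definition faithful :: "('o, 'm) category \<Rightarrow> ('o, 'm, 'o2, 'm2) functor_data \<Rightarrow> bool" where
  "faithful C F \<longleftrightarrow>
     (\<forall>X Y. \<forall>f \<in> hom C X Y. \<forall>g \<in> hom C X Y. FArr F f = FArr F g \<longrightarrow> f = g)"

definition natural_transformation ::
  "('o, 'm) category \<Rightarrow> ('o2, 'm2) category \<Rightarrow> ('o, 'm, 'o2, 'm2) functor_data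
    \<Rightarrow> ('o, 'm, 'o2, 'm2) functor_data \<Rightarrow> ('o \<Rightarrow> 'm2) \<Rightarrow> bool" where
  "natural_transformation C D F G \<tau> \<longleftrightarrow>
     cat_functor C D F \<and> cat_functor C D G \<and>
     (\<forall>X \<in> Obj C. \<tau> X \<in> hom D (FObj F X) (FObj G X)) \<and>
     (\<forall>X Y. \<forall>f \<in> hom C X Y. \<tau> Y \<cdot>\<^bsub>D\<^esub> FArr F f = FArr G f \<cdot>\<^bsub>D\<^esub> \<tau> X)"

definition left_adjoint_with_unit ::
  "('o, 'm) category \<Rightarrow> ('o2, 'm2) category \<Rightarrow> ('o, 'm, 'o2, 'm2) functor_data
    \<Rightarrow> ('o2, 'm2, 'o, 'm) functor_data \<Rightarrow> ('o \<Rightarrow> 'm) \<Rightarrow> bool" where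
  "left_adjoint_with_unit C B L G \<delta> \<longleftrightarrow>
     cat_functor C B L \<and> cat_functor B C G \<and>
     natural_transformation C C id_functor (comp_functor G L) \<delta> \<and>
     (\<exists>\<epsilon>. natural_transformation B B (comp_functor L G) id_functor \<epsilon> \<and>
        (\<forall>X \<in> Obj C. \<epsilon> (FObj L X) \<cdot>\<^bsub>B\<^esub> FArr L (\<delta> X) = Ident B (FObj L X)) \<and>
        (\<forall>Y \<in> Obj B. FArr G (\<epsilon> Y) \<cdot>\<^bsub>C\<^esub> \<delta> (FObj G Y) = Ident C (FObj G Y)))"

definition cone ::
  "('i, 'j) category \<Rightarrow> ('o, 'm) category \<Rightarrow> ('i, 'j, 'o, 'm) functor_data \<Rightarrow> 'o
    \<Rightarrow> ('i \<Rightarrow> 'm) \<Rightarrow> bool" where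
  "cone J C D N \<pi> \<longleftrightarrow> N \<in> Obj C \<and> (\<forall>j \<in> Obj J. \<pi> j \<in> hom C N (FObj D j)) \<and>
     (\<forall>u \<in> Arr J. FArr D u \<cdot>\<^bsub>C\<^esub> \<pi> (Dom J u) = \<pi> (Cod J u))"

definition limit_cone ::
  "('i, 'j) category \<Rightarrow> ('o, 'm) category \<Rightarrow> ('i, 'j, 'o, 'm) functor_data \<Rightarrow> 'o
    \<Rightarrow> ('i \<Rightarrow> 'm) \<Rightarrow> bool" where
  "limit_cone J C D N \<pi> \<longleftrightarrow> cone J C D N \<pi> \<and>
     (\<forall>N' \<pi>'. cone J C D N' \<pi>' \<longrightarrow>
        (\<exists>!h. h \<in> hom C N' N \<and> (\<forall>j \<in> Obj J. \<pi> j \<cdot>\<^bsub>C\<^esub> h = \<pi>' j)))"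

text \<open>Every finite category is isomorphic to one whose objects and arrows are natural numbers,
  so quantifying over index categories of that type loses nothing.\<close>

definition finitely_complete :: "('o, 'm) category \<Rightarrow> bool" where
  "finitely_complete C \<longleftrightarrow>
     (\<forall>(J :: (nat, nat) category) D. finite (Obj J) \<and> finite (Arr J) \<and> cat_functor J C D
        \<longrightarrow> (\<exists>N \<pi>. limit_cone J C D N \<pi>))"

text \<open>The pullback of \<open>f\<close> and \<open>g\<close>, with projections satisfying \<open>f \<cdot> p = g \<cdot> q\<close>.\<close>

definition is_pullback :: "('o, 'm) category \<Rightarrow> 'm \<Rightarrow> 'm \<Rightarrow> 'm \<Rightarrow> 'm \<Rightarrow> bool" where
  "is_pullback C f g p q \<longleftrightarrow>
     f \<in> Arr C \<and> g \<in> Arr C \<and> Cod C f = Cod C g \<and>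
     (\<exists>P. p \<in> hom C P (Dom C f) \<and> q \<in> hom C P (Dom C g) \<and> f \<cdot>\<^bsub>C\<^esub> p = g \<cdot>\<^bsub>C\<^esub> q \<and>
        (\<forall>Z. \<forall>a \<in> hom C Z (Dom C f). \<forall>b \<in> hom C Z (Dom C g). f \<cdot>\<^bsub>C\<^esub> a = g \<cdot>\<^bsub>C\<^esub> b \<longrightarrow>
           (\<exists>!u. u \<in> hom C Z P \<and> p \<cdot>\<^bsub>C\<^esub> u = a \<and> q \<cdot>\<^bsub>C\<^esub> u = b)))"

definition is_equalizer :: "('o, 'm) category \<Rightarrow> 'm \<Rightarrow> 'm \<Rightarrow> 'm \<Rightarrow> bool" where
  "is_equalizer C g h m \<longleftrightarrow>
     (\<exists>E X Y. g \<in> hom C X Y \<and> h \<in> hom C X Y \<and> m \<in> hom C E X \<and> g \<cdot>\<^bsub>C\<^esub> m = h \<cdot>\<^bsub>C\<^esub> m \<and>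
        (\<forall>Z. \<forall>k \<in> hom C Z X. g \<cdot>\<^bsub>C\<^esub> k = h \<cdot>\<^bsub>C\<^esub> k \<longrightarrow> (\<exists>!u. u \<in> hom C Z E \<and> m \<cdot>\<^bsub>C\<^esub> u = k)))"

definition is_coequalizer :: "('o, 'm) category \<Rightarrow> 'm \<Rightarrow> 'm \<Rightarrow> 'm \<Rightarrow> bool" where
  "is_coequalizer C g h e \<longleftrightarrow> is_equalizer (opposite C) g h e"

definition regular_mono :: "('o, 'm) category \<Rightarrow> 'm \<Rightarrow> bool" where
  "regular_mono C m \<longleftrightarrow> (\<exists>g h. is_equalizer C g h m)"

definition regular_epi :: "('o, 'm) category \<Rightarrow> 'm \<Rightarrow> bool" where
  "regular_epi C e \<longleftrightarrow> (\<exists>g h. is_coequalizer C g h e)"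

definition regular_category :: "('o, 'm) category \<Rightarrow> bool" where
  "regular_category C \<longleftrightarrow> category C \<and> finitely_complete C \<and>
     (\<forall>f p q. is_pullback C f f p q \<longrightarrow> (\<exists>e. is_coequalizer C p q e)) \<and>
     (\<forall>f g p q. is_pullback C f g p q \<and> regular_epi C f \<longrightarrow> regular_epi C q)"

definition coregular_category :: "('o, 'm) category \<Rightarrow> bool" where
  "coregular_category C \<longleftrightarrow> regular_category (opposite C)"

definition coimage_factorization :: "('o, 'm) category \<Rightarrow> 'm \<Rightarrow> 'm \<Rightarrow> 'm \<Rightarrow> bool" where
  "coimage_factorization C h m e \<longleftrightarrow>
     h \<in> Arr C \<and> epi C e \<and> regular_mono C m \<and>
     Dom C e = Dom C h \<and> Cod C e = Dom C m \<and> Cod C m = Cod C h \<and> h = m \<cdot>\<^bsub>C\<^esub> e"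

type_synonym ('oa, 'mc, 'ob) comma_obj = "'oa \<times> 'mc \<times> 'ob"

text \<open>An arrow of the comma category is a pair \<open>(\<phi>, \<psi>)\<close> together with its source and target:
  the same pair may be a morphism between several pairs of objects.\<close>

type_synonym ('oa, 'ma, 'mc, 'ob, 'mb) comma_arr =
  "('oa, 'mc, 'ob) comma_obj \<times> ('ma \<times> 'mb) \<times> ('oa, 'mc, 'ob) comma_obj"

definition comma ::
  "('oa, 'ma) category \<Rightarrow> ('ob, 'mb) category \<Rightarrow> ('oc, 'mc) category
    \<Rightarrow> ('oa, 'ma, 'oc, 'mc) functor_data \<Rightarrow> ('ob, 'mb, 'oc, 'mc) functor_data
    \<Rightarrow> (('oa, 'mc, 'ob) comma_obj, ('oa, 'ma, 'mc, 'ob, 'mb) comma_arr) category" where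
  "comma \<A> \<B> \<C> F G =
    (let objs = {(A, f, B). A \<in> Obj \<A> \<and> B \<in> Obj \<B> \<and> f \<in> hom \<C> (FObj F A) (FObj G B)}
     in \<lparr>Obj = objs,
       Arr = {((A, f, B), (\<phi>, \<psi>), (A', f', B')) | A f B \<phi> \<psi> A' f' B'.
          (A, f, B) \<in> objs \<and> (A', f', B') \<in> objs \<and>
          \<phi> \<in> hom \<A> A A' \<and> \<psi> \<in> hom \<B> B B' \<and>
          f' \<cdot>\<^bsub>\<C>\<^esub> FArr F \<phi> = FArr G \<psi> \<cdot>\<^bsub>\<C>\<^esub> f},
       Dom = (\<lambda>(X, _, Y). X),
       Cod = (\<lambda>(X, _, Y). Y),
       Ident = (\<lambda>(A, f, B). ((A, f, B), (Ident \<A> A, Ident \<B> B), (A, f, B))),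
       Comp = (\<lambda>(_, (\<phi>', \<psi>'), Z) (X, (\<phi>, \<psi>), _). (X, (\<phi>' \<cdot>\<^bsub>\<A>\<^esub> \<phi>, \<psi>' \<cdot>\<^bsub>\<B>\<^esub> \<psi>), Z))\<rparr>)"

definition cosimple :: "('oc, 'mc) category \<Rightarrow> ('oa, 'mc, 'ob) comma_obj \<Rightarrow> bool" where
  "cosimple \<C> X \<longleftrightarrow> (case X of (A, f, B) \<Rightarrow> epi \<C> f)"

definition cosimple_subcategory ::
  "('oa, 'ma) category \<Rightarrow> ('ob, 'mb) category \<Rightarrow> ('oc, 'mc) category
    \<Rightarrow> ('oa, 'ma, 'oc, 'mc) functor_data \<Rightarrow> ('ob, 'mb, 'oc, 'mc) functor_data
    \<Rightarrow> (('oa, 'mc, 'ob) comma_obj, ('oa, 'ma, 'mc, 'ob, 'mb) comma_arr) category" where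
  "cosimple_subcategory \<A> \<B> \<C> F G =
     full_subcategory (comma \<A> \<B> \<C> F G) {X. cosimple \<C> X}"

text \<open>\<open>tilde \<B> \<C> F G L \<delta> (A, f, B)\<close> is the transpose of \<open>f\<close> across the adjunction with left
  adjoint \<open>L\<close> and unit \<open>\<delta>\<close>.\<close>

definition tilde ::
  "('ob, 'mb) category \<Rightarrow> ('oc, 'mc) category
    \<Rightarrow> ('oa, 'ma, 'oc, 'mc) functor_data \<Rightarrow> ('ob, 'mb, 'oc, 'mc) functor_data
    \<Rightarrow> ('oc, 'mc, 'ob, 'mb) functor_data \<Rightarrow> ('oc \<Rightarrow> 'mc)
    \<Rightarrow> ('oa, 'mc, 'ob) comma_obj \<Rightarrow> 'mb" where
  "tilde \<B> \<C> F G L \<delta> = (\<lambda>(A, f, B).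
     THE h. h \<in> hom \<B> (FObj L (FObj F A)) B \<and> FArr G h \<cdot>\<^bsub>\<C>\<^esub> \<delta> (FObj F A) = f)"

text \<open>The argument \<open>e\<close> (resp. \<open>m\<close>) assigns to an arrow of \<open>\<B>\<close> the epimorphism (resp. the regular
  monomorphism) of a chosen coimage factorization; \<open>coran\<close> is the codomain of the epimorphism.\<close>

definition cosimple_part ::
  "('ob, 'mb) category \<Rightarrow> ('oc, 'mc) category
    \<Rightarrow> ('oa, 'ma, 'oc, 'mc) functor_data \<Rightarrow> ('ob, 'mb, 'oc, 'mc) functor_data
    \<Rightarrow> ('oc, 'mc, 'ob, 'mb) functor_data \<Rightarrow> ('oc \<Rightarrow> 'mc) \<Rightarrow> ('mb \<Rightarrow> 'mb)
    \<Rightarrow> ('oa, 'mc, 'ob) comma_obj \<Rightarrow> ('oa, 'mc, 'ob) comma_obj" where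
  "cosimple_part \<B> \<C> F G L \<delta> e = (\<lambda>(A, f, B).
     let ef = e (tilde \<B> \<C> F G L \<delta> (A, f, B))
     in (A, FArr G ef \<cdot>\<^bsub>\<C>\<^esub> \<delta> (FObj F A), Cod \<B> ef))"

definition cosimple_part_arr ::
  "('oa, 'ma) category \<Rightarrow> ('ob, 'mb) category \<Rightarrow> ('oc, 'mc) category
    \<Rightarrow> ('oa, 'ma, 'oc, 'mc) functor_data \<Rightarrow> ('ob, 'mb, 'oc, 'mc) functor_data
    \<Rightarrow> ('oc, 'mc, 'ob, 'mb) functor_data \<Rightarrow> ('oc \<Rightarrow> 'mc) \<Rightarrow> ('mb \<Rightarrow> 'mb) \<Rightarrow> ('mb \<Rightarrow> 'mb)
    \<Rightarrow> ('oa, 'mc, 'ob) comma_obj \<Rightarrow> ('oa, 'ma, 'mc, 'ob, 'mb) comma_arr" where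
  "cosimple_part_arr \<A> \<B> \<C> F G L \<delta> e m = (\<lambda>(A, f, B).
     (cosimple_part \<B> \<C> F G L \<delta> e (A, f, B),
      (Ident \<A> A, m (tilde \<B> \<C> F G L \<delta> (A, f, B))),
      (A, f, B)))"

lemma category_opposite:
  assumes "category C" shows "category (opposite C)"
  using assms unfolding category_def hom_def opposite_def by auto

lemma opposite_opposite: "opposite (opposite C) = C"
  by (simp add: opposite_def)

lemma homD: "f \<in> hom C X Y \<Longrightarrow> f \<in> Arr C \<and> Dom C f = X \<and> Cod C f = Y"
  by (simp add: hom_def)

lemma homI: "f \<in> Arr C \<Longrightarrow> f \<in> hom C (Dom C f) (Cod C f)"
  by (simp add: hom_def)

lemma comma_Obj:
  "(A, f, B) \<in> Obj (comma \<A> \<B> \<C> F G) \<longleftrightarrow>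
    A \<in> Obj \<A> \<and> B \<in> Obj \<B> \<and> f \<in> hom \<C> (FObj F A) (FObj G B)"
  by (simp add: comma_def Let_def)

lemma comma_hom:
  "t \<in> hom (comma \<A> \<B> \<C> F G) (A, f, B) (A', f', B') \<longleftrightarrow>
    (A, f, B) \<in> Obj (comma \<A> \<B> \<C> F G) \<and> (A', f', B') \<in> Obj (comma \<A> \<B> \<C> F G) \<and>
    (\<exists>\<phi> \<psi>. t = ((A, f, B), (\<phi>, \<psi>), (A', f', B')) \<and> \<phi> \<in> hom \<A> A A' \<and> \<psi> \<in> hom \<B> B B' \<and>
      f' \<cdot>\<^bsub>\<C>\<^esub> FArr F \<phi> = FArr G \<psi> \<cdot>\<^bsub>\<C>\<^esub> f)"
  unfolding comma_Obj unfolding hom_def[of "comma \<A> \<B> \<C> F G"]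
  by (auto simp: comma_def Let_def)

lemma comma_Comp:
  "(Y, (\<phi>', \<psi>'), Z) \<cdot>\<^bsub>comma \<A> \<B> \<C> F G\<^esub> (X, (\<phi>, \<psi>), Y') =
    (X, (\<phi>' \<cdot>\<^bsub>\<A>\<^esub> \<phi>, \<psi>' \<cdot>\<^bsub>\<B>\<^esub> \<psi>), Z)"
  by (simp add: comma_def Let_def)

lemma comma_Ident:
  "Ident (comma \<A> \<B> \<C> F G) (A, f, B) = ((A, f, B), (Ident \<A> A, Ident \<B> B), (A, f, B))"
  by (simp add: comma_def Let_def)

lemma category_comma:
  assumes "cat_functor \<A> \<C> F" "cat_functor \<B> \<C> G"
  shows "category (comma \<A> \<B> \<C> F G)"
proof -
  interpret F: cat_functor \<A> \<C> F by fact
  interpret G: cat_functor \<B> \<C> G by fact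
  let ?K = "comma \<A> \<B> \<C> F G"
  show ?thesis
  proof
    show "Dom ?K t \<in> Obj ?K" "Cod ?K t \<in> Obj ?K" if "t \<in> Arr ?K" for t
      using that by (auto simp: comma_def Let_def)
    show "Ident ?K X \<in> hom ?K X X" if "X \<in> Obj ?K" for X
      using that by (cases X) (auto simp: comma_hom comma_Ident comma_Obj F.FArr_Ident G.FArr_Ident
          F.cod.Comp_Ident F.cod.Ident_Comp F.dom.Ident_hom G.dom.Ident_hom)
    show "t \<cdot>\<^bsub>?K\<^esub> Ident ?K X = t" "Ident ?K Y \<cdot>\<^bsub>?K\<^esub> t = t" if "t \<in> hom ?K X Y" for t X Y
      using that by (cases X; cases Y; auto simp: comma_hom comma_Ident comma_Comp
          F.dom.Comp_Ident F.dom.Ident_Comp G.dom.Comp_Ident G.dom.Ident_Comp)+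
    show "(v \<cdot>\<^bsub>?K\<^esub> u) \<cdot>\<^bsub>?K\<^esub> t = v \<cdot>\<^bsub>?K\<^esub> (u \<cdot>\<^bsub>?K\<^esub> t)"
      if "t \<in> hom ?K W X" "u \<in> hom ?K X Y" "v \<in> hom ?K Y Z" for t u v W X Y Z
      using that by (cases W; cases X; cases Y; cases Z)
        (auto simp: comma_hom comma_Comp F.dom.Comp_assoc G.dom.Comp_assoc)
    show "u \<cdot>\<^bsub>?K\<^esub> t \<in> hom ?K X Z" if t: "t \<in> hom ?K X Y" and u: "u \<in> hom ?K Y Z" for t u X Y Z
    proof -
      obtain A f B A' f' B' A'' f'' B'' where
        e: "X = (A, f, B)" "Y = (A', f', B')" "Z = (A'', f'', B'')" by (cases X; cases Y; cases Z)
      obtain p q where p: "t = (X, (p, q), Y)" "p \<in> hom \<A> A A'" "q \<in> hom \<B> B B'"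
        "f' \<cdot>\<^bsub>\<C>\<^esub> FArr F p = FArr G q \<cdot>\<^bsub>\<C>\<^esub> f" "X \<in> Obj ?K" "Y \<in> Obj ?K"
        using t unfolding e comma_hom by blast
      obtain p' q' where p': "u = (Y, (p', q'), Z)" "p' \<in> hom \<A> A' A''" "q' \<in> hom \<B> B' B''"
        "f'' \<cdot>\<^bsub>\<C>\<^esub> FArr F p' = FArr G q' \<cdot>\<^bsub>\<C>\<^esub> f'" "Z \<in> Obj ?K"
        using u unfolding e comma_hom by blast
      have f: "f \<in> hom \<C> (FObj F A) (FObj G B)" "f' \<in> hom \<C> (FObj F A') (FObj G B')"
        "f'' \<in> hom \<C> (FObj F A'') (FObj G B'')"
        using p p' e by (auto simp: comma_Obj)
      have "f'' \<cdot>\<^bsub>\<C>\<^esub> FArr F (p' \<cdot>\<^bsub>\<A>\<^esub> p) = (f'' \<cdot>\<^bsub>\<C>\<^esub> FArr F p') \<cdot>\<^bsub>\<C>\<^esub> FArr F p"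
        using F.FArr_Comp[OF p(2) p'(2)] F.cod.Comp_assoc[OF F.FArr_hom[OF p(2)] F.FArr_hom[OF p'(2)] f(3)]
        by simp
      also have "\<dots> = FArr G q' \<cdot>\<^bsub>\<C>\<^esub> (f' \<cdot>\<^bsub>\<C>\<^esub> FArr F p)"
        using p'(4) F.cod.Comp_assoc[OF F.FArr_hom[OF p(2)] f(2) G.FArr_hom[OF p'(3)]] by simp
      also have "\<dots> = FArr G (q' \<cdot>\<^bsub>\<B>\<^esub> q) \<cdot>\<^bsub>\<C>\<^esub> f"
        using p(4) G.FArr_Comp[OF p(3) p'(3)]
          F.cod.Comp_assoc[OF f(1) G.FArr_hom[OF p(3)] G.FArr_hom[OF p'(3)]] by simp
      finally show ?thesis
        using p p' e F.dom.Comp_hom[OF p(2) p'(2)] G.dom.Comp_hom[OF p(3) p'(3)]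
        by (auto simp: comma_hom comma_Comp)
    qed
  qed
qed

lemma category_full_subcategory:
  assumes "category C" shows "category (full_subcategory C S)"
  using assms unfolding category_def hom_def full_subcategory_def by auto

lemma cat_functor_inclusion:
  assumes "category C" shows "cat_functor (full_subcategory C S) C inclusion_functor"
  using assms category_full_subcategory[OF assms, of S]
  by (simp add: cat_functor_def cat_functor_axioms_def inclusion_functor_def id_functor_def)
    (auto simp: full_subcategory_def hom_def)

lemma transpose_unique:
  assumes adj: "left_adjoint_with_unit \<C> \<B> L G \<delta>"
    and X: "X \<in> Obj \<C>" and Y: "Y \<in> Obj \<B>" and f: "f \<in> hom \<C> X (FObj G Y)"
  shows "\<exists>!h. h \<in> hom \<B> (FObj L X) Y \<and> FArr G h \<cdot>\<^bsub>\<C>\<^esub> \<delta> X = f"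
proof -
  interpret L: cat_functor \<C> \<B> L using adj by (simp add: left_adjoint_with_unit_def)
  interpret G: cat_functor \<B> \<C> G using adj by (simp add: left_adjoint_with_unit_def)
  obtain \<epsilon> where eps: "\<And>Y. Y \<in> Obj \<B> \<Longrightarrow> \<epsilon> Y \<in> hom \<B> (FObj L (FObj G Y)) Y"
    and epsn: "\<And>X Y f. f \<in> hom \<B> X Y \<Longrightarrow> \<epsilon> Y \<cdot>\<^bsub>\<B>\<^esub> FArr L (FArr G f) = f \<cdot>\<^bsub>\<B>\<^esub> \<epsilon> X"
    and t1: "\<And>X. X \<in> Obj \<C> \<Longrightarrow> \<epsilon> (FObj L X) \<cdot>\<^bsub>\<B>\<^esub> FArr L (\<delta> X) = Ident \<B> (FObj L X)"
    and t2: "\<And>Y. Y \<in> Obj \<B> \<Longrightarrow> FArr G (\<epsilon> Y) \<cdot>\<^bsub>\<C>\<^esub> \<delta> (FObj G Y) = Ident \<C> (FObj G Y)"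
    using adj unfolding left_adjoint_with_unit_def natural_transformation_def
    by (simp add: id_functor_def comp_functor_def) blast
  have d: "\<And>X. X \<in> Obj \<C> \<Longrightarrow> \<delta> X \<in> hom \<C> X (FObj G (FObj L X))"
    and dn: "\<And>X Y f. f \<in> hom \<C> X Y \<Longrightarrow> \<delta> Y \<cdot>\<^bsub>\<C>\<^esub> f = FArr G (FArr L f) \<cdot>\<^bsub>\<C>\<^esub> \<delta> X"
    using adj unfolding left_adjoint_with_unit_def natural_transformation_def
    by (auto simp: id_functor_def comp_functor_def)
  note e = eps[OF Y] and Lf = L.FArr_hom[OF f] and GY = G.FObj_Obj[OF Y] and LX = L.FObj_Obj[OF X]
  let ?h = "\<epsilon> Y \<cdot>\<^bsub>\<B>\<^esub> FArr L f"
  have "FArr G ?h \<cdot>\<^bsub>\<C>\<^esub> \<delta> X = FArr G (\<epsilon> Y) \<cdot>\<^bsub>\<C>\<^esub> (FArr G (FArr L f) \<cdot>\<^bsub>\<C>\<^esub> \<delta> X)"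
    using G.FArr_Comp[OF Lf e] L.dom.Comp_assoc[OF d[OF X] G.FArr_hom[OF Lf] G.FArr_hom[OF e]]
    by simp
  also have "\<dots> = (FArr G (\<epsilon> Y) \<cdot>\<^bsub>\<C>\<^esub> \<delta> (FObj G Y)) \<cdot>\<^bsub>\<C>\<^esub> f"
    using dn[OF f] L.dom.Comp_assoc[OF f d[OF GY] G.FArr_hom[OF e]] by simp
  also have "\<dots> = f" using t2[OF Y] L.dom.Ident_Comp[OF f] by simp
  finally have 1: "FArr G ?h \<cdot>\<^bsub>\<C>\<^esub> \<delta> X = f" .
  have 2: "k = ?h" if k: "k \<in> hom \<B> (FObj L X) Y" and kf: "FArr G k \<cdot>\<^bsub>\<C>\<^esub> \<delta> X = f" for k
  proof -
    note Ld = L.FArr_hom[OF d[OF X]]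
    have "?h = \<epsilon> Y \<cdot>\<^bsub>\<B>\<^esub> (FArr L (FArr G k) \<cdot>\<^bsub>\<B>\<^esub> FArr L (\<delta> X))"
      using L.FArr_Comp[OF d[OF X] G.FArr_hom[OF k]] kf by simp
    also have "\<dots> = (k \<cdot>\<^bsub>\<B>\<^esub> \<epsilon> (FObj L X)) \<cdot>\<^bsub>\<B>\<^esub> FArr L (\<delta> X)"
      using L.cod.Comp_assoc[OF Ld L.FArr_hom[OF G.FArr_hom[OF k]] e] epsn[OF k] by simp
    also have "\<dots> = k"
      using L.cod.Comp_assoc[OF Ld eps[OF LX] k] t1[OF X] L.cod.Comp_Ident[OF k] by simp
    finally show ?thesis by simp
  qed
  show ?thesis using 1 2 L.cod.Comp_hom[OF Lf e] by blast
qed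

lemma tilde:
  assumes "cat_functor \<A> \<C> F" "left_adjoint_with_unit \<C> \<B> L G \<delta>"
    and "(A, f, B) \<in> Obj (comma \<A> \<B> \<C> F G)"
  shows "tilde \<B> \<C> F G L \<delta> (A, f, B) \<in> hom \<B> (FObj L (FObj F A)) B"
    and "FArr G (tilde \<B> \<C> F G L \<delta> (A, f, B)) \<cdot>\<^bsub>\<C>\<^esub> \<delta> (FObj F A) = f"
proof -
  have "\<exists>!h. h \<in> hom \<B> (FObj L (FObj F A)) B \<and> FArr G h \<cdot>\<^bsub>\<C>\<^esub> \<delta> (FObj F A) = f"
    using assms by (intro transpose_unique) (auto simp: comma_Obj cat_functor.FObj_Obj)
  from theI'[OF this]
  show "tilde \<B> \<C> F G L \<delta> (A, f, B) \<in> hom \<B> (FObj L (FObj F A)) B"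
    and "FArr G (tilde \<B> \<C> F G L \<delta> (A, f, B)) \<cdot>\<^bsub>\<C>\<^esub> \<delta> (FObj F A) = f"
    by (simp_all add: tilde_def)
qed

lemma cosimple_part_arr_hom:
  assumes F: "cat_functor \<A> \<C> F" and adj: "left_adjoint_with_unit \<C> \<B> L G \<delta>"
    and X: "X \<in> Obj (comma \<A> \<B> \<C> F G)"
    and fac: "coimage_factorization \<B> (tilde \<B> \<C> F G L \<delta> X)
      (m (tilde \<B> \<C> F G L \<delta> X)) (e (tilde \<B> \<C> F G L \<delta> X))"
  shows "cosimple_part_arr \<A> \<B> \<C> F G L \<delta> e m X
    \<in> hom (comma \<A> \<B> \<C> F G) (cosimple_part \<B> \<C> F G L \<delta> e X) X"
proof -
  interpret F: cat_functor \<A> \<C> F by fact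
  interpret G: cat_functor \<B> \<C> G using adj by (simp add: left_adjoint_with_unit_def)
  obtain A f B where e: "X = (A, f, B)" by (cases X)
  let ?t = "tilde \<B> \<C> F G L \<delta> (A, f, B)"
  note t = tilde[OF F adj X[unfolded e]]
  have A: "A \<in> Obj \<A>" and B: "B \<in> Obj \<B>" and f: "f \<in> hom \<C> (FObj F A) (FObj G B)"
    using X by (auto simp: e comma_Obj)
  have d: "\<delta> (FObj F A) \<in> hom \<C> (FObj F A) (FObj G (FObj L (FObj F A)))"
    using adj F.FObj_Obj[OF A]
    by (auto simp: left_adjoint_with_unit_def natural_transformation_def id_functor_def comp_functor_def)
  have te: "e ?t \<in> hom \<B> (FObj L (FObj F A)) (Cod \<B> (e ?t))"
    and tm: "m ?t \<in> hom \<B> (Cod \<B> (e ?t)) B" and tme: "m ?t \<cdot>\<^bsub>\<B>\<^esub> e ?t = ?t"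
    using fac t(1) unfolding e
    by (auto simp: coimage_factorization_def hom_def epi_def regular_mono_def is_equalizer_def)
  have "FArr G (m ?t) \<cdot>\<^bsub>\<C>\<^esub> (FArr G (e ?t) \<cdot>\<^bsub>\<C>\<^esub> \<delta> (FObj F A)) = f"
    using F.cod.Comp_assoc[OF d G.FArr_hom[OF te] G.FArr_hom[OF tm]] G.FArr_Comp[OF te tm] tme t(2)
    by simp
  then show ?thesis
    using A B f te tm F.cod.Comp_hom[OF d G.FArr_hom[OF te]] G.dom.Cod_Obj[of "e ?t"]
    by (auto simp: e cosimple_part_arr_def cosimple_part_def Let_def comma_hom comma_Obj
        F.dom.Ident_hom F.FArr_Ident F.cod.Comp_Ident dest: homD)
qed

end

theory Submission
  imports Defs
begin

text \<open>When \<open>f\<close> is an epimorphism, faithfulness of \<open>G\<close> makes its transpose \<open>tilde f\<close> an epimorphism.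
  Transposing the square of \<open>(\<phi>, \<psi>)\<close> gives \<open>\<psi> \<cdot> tilde f = m \<cdot> (e \<cdot> L (F \<phi>))\<close>, where \<open>tilde f' = m \<cdot> e\<close>
  is the coimage factorization. Epimorphisms are orthogonal to regular monomorphisms, so \<open>\<psi>\<close>
  factors uniquely through \<open>m\<close>, and transposing back shows that the factor, together with \<open>\<phi>\<close>,
  is a morphism of the comma category.\<close>

text \<open>Write \<open>m\<close> as the equalizer of \<open>g\<close> and \<open>h\<close>. They
  agree on \<open>m \<cdot> q\<close>, hence on \<open>k \<cdot> p\<close>, and cancelling the
  epimorphism \<open>p\<close> makes them agree on \<open>k\<close>; the equalizer then supplies the
  diagonal. The first conclusion fixes the diagonal by the lower triangle alone, which serves for
  uniqueness; the second adds the upper triangle, which later yields the square of a comma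
  morphism.\<close>

lemma (in category) regular_mono_unique_lift:
  assumes m: "regular_mono C m"
    and p: "epi C p" "p \<in> hom C W X" and k: "k \<in> hom C X Y" and q: "q \<in> hom C W E"
    and mE: "m \<in> hom C E Y" and sq: "k \<cdot> p = m \<cdot> q"
  shows "\<exists>!d. d \<in> hom C X E \<and> m \<cdot> d = k" and "\<exists>d. d \<in> hom C X E \<and> m \<cdot> d = k \<and> d \<cdot> p = q"
proof -
  obtain g h Z where g: "g \<in> hom C Y Z" and h: "h \<in> hom C Y Z" and gh: "g \<cdot> m = h \<cdot> m"
    and lift: "\<And>V l. l \<in> hom C V Y \<Longrightarrow> g \<cdot> l = h \<cdot> l \<Longrightarrow> \<exists>!u. u \<in> hom C V E \<and> m \<cdot> u = l"
    using m mE unfolding regular_mono_def is_equalizer_def by (auto simp: hom_def)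
  have eq: "g \<cdot> (m \<cdot> x) = h \<cdot> (m \<cdot> x)" if "x \<in> hom C V E" for x V
    using Comp_assoc[OF that mE g] Comp_assoc[OF that mE h] gh by simp
  have "(g \<cdot> k) \<cdot> p = (h \<cdot> k) \<cdot> p"
    using Comp_assoc[OF p(2) k g] Comp_assoc[OF p(2) k h] eq[OF q] sq by simp
  then have "g \<cdot> k = h \<cdot> k"
    using p Comp_hom[OF k g] Comp_hom[OF k h] by (auto simp: epi_def dest: homD)
  from lift[OF k this] show ex: "\<exists>!d. d \<in> hom C X E \<and> m \<cdot> d = k" .
  then obtain d where d: "d \<in> hom C X E" "m \<cdot> d = k" by blast
  \<comment> \<open>Both \<open>d \<cdot> p\<close> and \<open>q\<close> factor the same arrow
    through the equalizer, so its uniqueness clause identifies them.\<close>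
  have "m \<cdot> (d \<cdot> p) = m \<cdot> q"
    using Comp_assoc[OF p(2) d(1) mE] d(2) sq by simp
  then have "d \<cdot> p = q"
    using lift[OF Comp_hom[OF q mE] eq[OF q]] Comp_hom[OF p(2) d(1)] q by blast
  with d show "\<exists>d. d \<in> hom C X E \<and> m \<cdot> d = k \<and> d \<cdot> p = q" by blast
qed

text \<open>If \<open>g\<close> and \<open>h\<close> agree after \<open>t\<close>, their images
  under \<open>G\<close> agree after the epimorphism \<open>G t \<cdot> d\<close>; so the images are
  equal, and faithfulness gives \<open>g = h\<close>. In the application \<open>d\<close> is a
  component of the unit and the composite is \<open>f\<close>.\<close>

lemma epi_transpose:
  assumes G: "cat_functor \<B> \<C> G" and faith: "faithful \<B> G"
    and t: "t \<in> hom \<B> Y B" and d: "d \<in> hom \<C> X (FObj G Y)" and epi: "epi \<C> (FArr G t \<cdot>\<^bsub>\<C>\<^esub> d)"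
  shows "epi \<B> t"
proof -
  interpret G: cat_functor \<B> \<C> G by fact
  note Gt = G.FArr_hom[OF t]
  have "g = h" if g: "g \<in> hom \<B> B Z" and h: "h \<in> hom \<B> B Z" and gh: "g \<cdot>\<^bsub>\<B>\<^esub> t = h \<cdot>\<^bsub>\<B>\<^esub> t" for g h Z
  proof -
    have "FArr G g \<cdot>\<^bsub>\<C>\<^esub> (FArr G t \<cdot>\<^bsub>\<C>\<^esub> d) = FArr G h \<cdot>\<^bsub>\<C>\<^esub> (FArr G t \<cdot>\<^bsub>\<C>\<^esub> d)"
      using G.cod.Comp_assoc[OF d Gt G.FArr_hom[OF g]] G.cod.Comp_assoc[OF d Gt G.FArr_hom[OF h]]
        G.FArr_Comp[OF t g] G.FArr_Comp[OF t h] gh by simp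
    then have "FArr G g = FArr G h"
      using epi G.FArr_hom[OF g] G.FArr_hom[OF h] homD[OF G.cod.Comp_hom[OF d Gt]]
      unfolding epi_def by auto
    then show ?thesis using faith g h unfolding faithful_def by blast
  qed
  then show ?thesis using t by (auto simp: epi_def dest: homD)
qed

theorem mainTheorem12:
  fixes \<A> :: "('oa, 'ma) category" and \<B> :: "('ob, 'mb) category" and \<C> :: "('oc, 'mc) category"
    and F :: "('oa, 'ma, 'oc, 'mc) functor_data" and G :: "('ob, 'mb, 'oc, 'mc) functor_data"
    and L :: "('oc, 'mc, 'ob, 'mb) functor_data" and \<delta> :: "'oc \<Rightarrow> 'mc"
    and e m :: "'mb \<Rightarrow> 'mb"
    and A A' :: 'oa and f f' :: 'mc and B B' :: 'ob and \<phi> :: 'ma and \<psi> :: 'mb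
  defines "\<G> \<equiv> comma \<A> \<B> \<C> F G"
    and "\<T>\<G> \<equiv> cosimple_subcategory \<A> \<B> \<C> F G"
    and "\<T> \<equiv> cosimple_part \<B> \<C> F G L \<delta> e"
    and "\<theta> \<equiv> cosimple_part_arr \<A> \<B> \<C> F G L \<delta> e m"
  assumes "cat_functor \<A> \<C> F"
    and "cat_functor \<B> \<C> G"
    and "coregular_category \<B>"
    and "faithful \<B> G"
    and "left_adjoint_with_unit \<C> \<B> L G \<delta>"
    and "\<And>X. X \<in> Obj \<G> \<Longrightarrow>
      coimage_factorization \<B> (tilde \<B> \<C> F G L \<delta> X)
        (m (tilde \<B> \<C> F G L \<delta> X)) (e (tilde \<B> \<C> F G L \<delta> X))"
    and "(A, f, B) \<in> Obj \<T>\<G>"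
    and "(FObj inclusion_functor (A, f, B), (\<phi>, \<psi>), (A', f', B'))
      \<in> hom \<G> (FObj inclusion_functor (A, f, B)) (A', f', B')"
  shows "\<exists>!u. u \<in> hom \<G> (A, f, B) (\<T> (A', f', B')) \<and>
    \<theta> (A', f', B') \<cdot>\<^bsub>\<G>\<^esub> u = (FObj inclusion_functor (A, f, B), (\<phi>, \<psi>), (A', f', B'))"
proof -
  note F = assms(5) and G = assms(6) and faith = assms(8) and adj = assms(9)
  interpret F: cat_functor \<A> \<C> F by (rule F)
  interpret G: cat_functor \<B> \<C> G by (rule G)
  interpret L: cat_functor \<C> \<B> L using adj by (simp add: left_adjoint_with_unit_def)
  have \<delta>: "\<delta> X \<in> hom \<C> X (FObj G (FObj L X))" if "X \<in> Obj \<C>" for X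
    using adj that
    by (auto simp: left_adjoint_with_unit_def natural_transformation_def id_functor_def comp_functor_def)
  have \<delta>_nat: "\<delta> Y \<cdot>\<^bsub>\<C>\<^esub> k = FArr G (FArr L k) \<cdot>\<^bsub>\<C>\<^esub> \<delta> X" if "k \<in> hom \<C> X Y" for k X Y
    using adj that
    by (auto simp: left_adjoint_with_unit_def natural_transformation_def id_functor_def comp_functor_def)
  have X: "(A, f, B) \<in> Obj \<G>" and X': "(A', f', B') \<in> Obj \<G>" and epi: "epi \<C> f"
    and \<phi>: "\<phi> \<in> hom \<A> A A'" and \<psi>: "\<psi> \<in> hom \<B> B B'"
    and sq: "f' \<cdot>\<^bsub>\<C>\<^esub> FArr F \<phi> = FArr G \<psi> \<cdot>\<^bsub>\<C>\<^esub> f"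
    using assms(11,12)
    by (auto simp: \<G>_def \<T>\<G>_def cosimple_subcategory_def full_subcategory_def cosimple_def
        inclusion_functor_def id_functor_def comma_hom)
  define t where "t = tilde \<B> \<C> F G L \<delta> (A, f, B)"
  define t' where "t' = tilde \<B> \<C> F G L \<delta> (A', f', B')"
  note t = tilde[OF F adj X[unfolded \<G>_def], folded t_def]
  note t' = tilde[OF F adj X'[unfolded \<G>_def], folded t'_def]
  have A: "A \<in> Obj \<A>" "A' \<in> Obj \<A>" and B': "B' \<in> Obj \<B>"
    using X X' by (auto simp: \<G>_def comma_Obj)
  note dA = \<delta>[OF F.FObj_Obj[OF A(1)]] and dA' = \<delta>[OF F.FObj_Obj[OF A(2)]]
  note F\<phi> = F.FArr_hom[OF \<phi>]
  note LF\<phi> = L.FArr_hom[OF F\<phi>]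
  note fac = assms(10)[OF X', folded t'_def]
  define E where "E = Cod \<B> (e t')"
  have e: "e t' \<in> hom \<B> (FObj L (FObj F A')) E" and m: "m t' \<in> hom \<B> E B'"
    and me: "m t' \<cdot>\<^bsub>\<B>\<^esub> e t' = t'" and rm: "regular_mono \<B> (m t')"
  proof -
    have fac': "epi \<B> (e t')" "regular_mono \<B> (m t')" "Dom \<B> (e t') = Dom \<B> t'"
      "Cod \<B> (e t') = Dom \<B> (m t')" "Cod \<B> (m t') = Cod \<B> t'" and me': "t' = m t' \<cdot>\<^bsub>\<B>\<^esub> e t'"
      using fac unfolding coimage_factorization_def by blast+
    show "e t' \<in> hom \<B> (FObj L (FObj F A')) E" "m t' \<in> hom \<B> E B'" "regular_mono \<B> (m t')"
      using fac' homD[OF t'(1)]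
      by (auto simp: E_def hom_def epi_def regular_mono_def is_equalizer_def)
    show "m t' \<cdot>\<^bsub>\<B>\<^esub> e t' = t'" using me' by (rule sym)
  qed
  note eLF\<phi> = G.dom.Comp_hom[OF LF\<phi> e]
  have epi_t: "epi \<B> t"
    using epi_transpose[OF G faith t(1) dA] epi t(2) by simp
  \<comment> \<open>Naturality of the unit in its argument, used both for \<open>t'\<close> and for
    its epimorphic part \<open>e t'\<close>.\<close>
  have transpose_pre: "FArr G (k \<cdot>\<^bsub>\<B>\<^esub> FArr L (FArr F \<phi>)) \<cdot>\<^bsub>\<C>\<^esub> \<delta> (FObj F A)
      = (FArr G k \<cdot>\<^bsub>\<C>\<^esub> \<delta> (FObj F A')) \<cdot>\<^bsub>\<C>\<^esub> FArr F \<phi>" if k: "k \<in> hom \<B> (FObj L (FObj F A')) Y" for k Y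
    using G.FArr_Comp[OF LF\<phi> k] \<delta>_nat[OF F\<phi>]
      F.cod.Comp_assoc[OF dA G.FArr_hom[OF LF\<phi>] G.FArr_hom[OF k]]
      F.cod.Comp_assoc[OF F\<phi> dA' G.FArr_hom[OF k]] by simp
  \<comment> \<open>The transpose of \<open>t\<close> is \<open>f\<close>, so composing after
    \<open>t\<close> in \<open>\<B>\<close> matches composing after \<open>f\<close> in
    \<open>\<C>\<close>; used for \<open>\<psi>\<close> and for the lift \<open>d\<close>.\<close>
  have transpose_post: "FArr G (k \<cdot>\<^bsub>\<B>\<^esub> t) \<cdot>\<^bsub>\<C>\<^esub> \<delta> (FObj F A) = FArr G k \<cdot>\<^bsub>\<C>\<^esub> f"
    if k: "k \<in> hom \<B> B Y" for k Y
    using G.FArr_Comp[OF t(1) k] F.cod.Comp_assoc[OF dA G.FArr_hom[OF t(1)] G.FArr_hom[OF k]] t(2)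
    by simp
  have "FArr G (\<psi> \<cdot>\<^bsub>\<B>\<^esub> t) \<cdot>\<^bsub>\<C>\<^esub> \<delta> (FObj F A)
      = FArr G (t' \<cdot>\<^bsub>\<B>\<^esub> FArr L (FArr F \<phi>)) \<cdot>\<^bsub>\<C>\<^esub> \<delta> (FObj F A)"
    using transpose_pre[OF t'(1)] transpose_post[OF \<psi>] t'(2) sq by simp
  \<comment> \<open>Arrows out of \<open>L (F A)\<close> with equal transposes are equal, so the
    comma square of \<open>(\<phi>, \<psi>)\<close> becomes a square in \<open>\<B>\<close>.\<close>
  then have "\<psi> \<cdot>\<^bsub>\<B>\<^esub> t = t' \<cdot>\<^bsub>\<B>\<^esub> FArr L (FArr F \<phi>)"
    using transpose_unique[OF adj F.FObj_Obj[OF A(1)] B'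
        F.cod.Comp_hom[OF dA G.FArr_hom[OF G.dom.Comp_hom[OF LF\<phi> t'(1)]]]]
      G.dom.Comp_hom[OF t(1) \<psi>] G.dom.Comp_hom[OF LF\<phi> t'(1)] by blast
  then have "\<psi> \<cdot>\<^bsub>\<B>\<^esub> t = m t' \<cdot>\<^bsub>\<B>\<^esub> (e t' \<cdot>\<^bsub>\<B>\<^esub> FArr L (FArr F \<phi>))"
    using G.dom.Comp_assoc[OF LF\<phi> e m] me by simp
  note lift = G.dom.regular_mono_unique_lift[OF rm epi_t t(1) \<psi> eLF\<phi> m this]
  obtain d where d: "d \<in> hom \<B> B E" "m t' \<cdot>\<^bsub>\<B>\<^esub> d = \<psi>"
    and dt: "d \<cdot>\<^bsub>\<B>\<^esub> t = e t' \<cdot>\<^bsub>\<B>\<^esub> FArr L (FArr F \<phi>)"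
    using lift(2) by blast
  have T: "\<T> (A', f', B') = (A', FArr G (e t') \<cdot>\<^bsub>\<C>\<^esub> \<delta> (FObj F A'), E)"
    by (simp add: \<T>_def cosimple_part_def E_def t'_def Let_def)
  have \<theta>: "\<theta> (A', f', B') = (\<T> (A', f', B'), (Ident \<A> A', m t'), (A', f', B'))"
    by (simp add: \<theta>_def \<T>_def cosimple_part_arr_def t'_def)
  have TObj: "\<T> (A', f', B') \<in> Obj \<G>"
    using A G.dom.Cod_Obj[of "e t'"] homD[OF e] F.cod.Comp_hom[OF dA' G.FArr_hom[OF e]]
    by (auto simp: T \<G>_def comma_Obj)
  \<comment> \<open>Transposing the upper triangle \<open>dt\<close> back to \<open>\<C>\<close>
    gives exactly the condition for \<open>(\<phi>, d)\<close> to be a comma morphism into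
    \<open>\<T> (A', f', B')\<close>.\<close>
  have "(FArr G (e t') \<cdot>\<^bsub>\<C>\<^esub> \<delta> (FObj F A')) \<cdot>\<^bsub>\<C>\<^esub> FArr F \<phi> = FArr G d \<cdot>\<^bsub>\<C>\<^esub> f"
    using transpose_pre[OF e] transpose_post[OF d(1)] dt by simp
  then have u: "((A, f, B), (\<phi>, d), \<T> (A', f', B')) \<in> hom \<G> (A, f, B) (\<T> (A', f', B'))"
    using X TObj \<phi> d(1) by (simp add: T \<G>_def comma_hom)
  show ?thesis
  proof (rule ex1I[of _ "((A, f, B), (\<phi>, d), \<T> (A', f', B'))"], intro conjI u)
    show "\<theta> (A', f', B') \<cdot>\<^bsub>\<G>\<^esub> ((A, f, B), (\<phi>, d), \<T> (A', f', B'))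
        = (FObj inclusion_functor (A, f, B), (\<phi>, \<psi>), (A', f', B'))"
      using d(2) F.dom.Ident_Comp[OF \<phi>]
      by (simp add: \<theta> \<G>_def comma_Comp inclusion_functor_def id_functor_def)
  next
    fix v
    assume v: "v \<in> hom \<G> (A, f, B) (\<T> (A', f', B')) \<and>
      \<theta> (A', f', B') \<cdot>\<^bsub>\<G>\<^esub> v = (FObj inclusion_functor (A, f, B), (\<phi>, \<psi>), (A', f', B'))"
    then obtain \<alpha> \<beta> where v_eq: "v = ((A, f, B), (\<alpha>, \<beta>), \<T> (A', f', B'))"
      and \<alpha>: "\<alpha> \<in> hom \<A> A A'" and \<beta>: "\<beta> \<in> hom \<B> B E"
      unfolding T \<G>_def comma_hom by blast
    have "Ident \<A> A' \<cdot>\<^bsub>\<A>\<^esub> \<alpha> = \<phi>" "m t' \<cdot>\<^bsub>\<B>\<^esub> \<beta> = \<psi>"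
      using v by (simp_all add: v_eq \<theta> \<G>_def comma_Comp)
    \<comment> \<open>The first component is composed with an identity, and the second is determined
      by its composite with \<open>m t'\<close>.\<close>
    then have "\<alpha> = \<phi>" "\<beta> = d"
      using F.dom.Ident_Comp[OF \<alpha>] lift(1) \<beta> d by auto
    then show "v = ((A, f, B), (\<phi>, d), \<T> (A', f', B'))" by (simp add: v_eq)
  qed
qed

end
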